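(* Let $Y$ be a non-empty subset of a topological vector space $E$ and let $K$ be an $(n-1)$-dimensional simplex in a topological vector space $F$. Let $T:K\to 2^{Y}$ be a weakly naturally quasi-concave correspondence. Then $T$ has a continuous selection on $K$, i.e. there exists a continuous function $f:K\to Y$ such that $f(x)\in T(x)$ for every $x\in K$.
   Context: $2^{Y}$ denotes the family of all subsets of $Y$; a correspondence $T:X\to 2^{Y}$ is a set-valued map. An $(n-1)$-dimensional simplex is the convex hull of $n$ affinely independent points. Let $\Delta_{n-1}=\{(\lambda_1,\dots,\lambda_n)\in\mathbb{R}^n:\sum_{i=1}^n\lambda_i=1,\ \lambda_i\ge 0 \text{ for all } i\}$. Weakly naturally quasi-concave (WNQ): let $X$ be a non-empty convex subset of a topological vector space and $Y$ a non-empty subset of a topological vector space. A correspondence $T:X\to 2^{Y}$ is weakly naturally quasi-concave if for each $n$ and each finite set $\{x_1,\dots,x_n\}\subset X$ there exist $y_i\in T(x_i)$ ($i=1,\dots,n$) and continuous functions $g_i:[0,1]\to[0,1]$ with $g_i(0)=0$ and $g_i(1)=1$ ($i=1,\dots,n$) such that $(g_1(\lambda_1),\dots,g_n(\lambda_n))\in\Delta_{n-1}$ whenever $(\lambda_1,\dots,\lambda_n)\in\Delta_{n-1}$, and such that for every $(\lambda_1,\dots,\lambda_n)\in\Delta_{n-1}$ one has $\sum_{i=1}^n g_i(\lambda_i)y_i\in T\left(\sum_{i=1}^n\lambda_i x_i\right)$.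
   Formalization: The space F containing the simplex K is assumed Hausdorff; without this the claim fails (F = ℝ with the indiscrete topology, K = Y = [0,1], E = ℝ, T(x) = {x}). *)

theory Defs
  imports "HOL-Analysis.Analysis" "HOL-Homology.Simplices"
begin

text \<open>
  Real topological vector spaces; no separation axiom is built in. Joint continuity of
  scalar multiplication is phrased in the style of \<^class>\<open>topological_monoid_add\<close>.
  For the space containing a simplex, \<^class>\<open>t2_space\<close> is to be required in addition:
  otherwise barycentric coordinates need not be continuous.
\<close>

class real_topological_vector_space = real_vector + topological_ab_group_add +
  assumes tendsto_scaleR_Pair:
    "LIM x (nhds a \<times>\<^sub>F nhds b). fst x *\<^sub>R snd x :> nhds (a *\<^sub>R b)"

instance real_normed_vector \<subseteq> real_topological_vector_space
proof
  fix a :: real and b :: 'a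
  show "LIM x (nhds a \<times>\<^sub>F nhds b). fst x *\<^sub>R snd x :> nhds (a *\<^sub>R b)"
    by (intro tendsto_scaleR filterlim_fst filterlim_snd)
qed

text \<open>
  The library's \<^const>\<open>simplex\<close> is restricted to Euclidean spaces; this is the same
  notion, for a natural number dimension, in an arbitrary real vector space.
\<close>

definition is_simplex :: "nat \<Rightarrow> 'a::real_vector set \<Rightarrow> bool" where
  "is_simplex d K \<longleftrightarrow>
     (\<exists>C. finite C \<and> card C = d + 1 \<and> \<not> affine_dependent C \<and> K = convex hull C)"

text \<open>
  Points are indexed by \<open>0, \<dots>, n - 1\<close> with \<open>n \<ge> 1\<close>. The set \<open>\<Delta>\<^bsub>n-1\<^esub>\<close> is
  \<^term>\<open>standard_simplex (n - 1)\<close>, whose elements are the coordinate functions that vanish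
  at all indices from \<open>n\<close> on; this is why the tuple \<open>(g\<^sub>i (\<lambda>\<^sub>i))\<^sub>i\<close> is padded with zeros.
  Since \<open>{x\<^sub>1, \<dots>, x\<^sub>n}\<close> is a set, the points are distinct. The argument \<open>X\<close> is the
  domain of the correspondence \<open>T\<close>; values of \<open>T\<close> outside \<open>X\<close> are irrelevant.
\<close>

definition weakly_naturally_quasi_concave ::
  "'a::real_topological_vector_space set \<Rightarrow> ('a \<Rightarrow> 'b::real_topological_vector_space set) \<Rightarrow> bool"
where
  "weakly_naturally_quasi_concave X T \<longleftrightarrow>
     (\<forall>n\<ge>1. \<forall>x :: nat \<Rightarrow> 'a. inj_on x {..<n} \<and> x ` {..<n} \<subseteq> X \<longrightarrow>
       (\<exists>(y :: nat \<Rightarrow> 'b) (g :: nat \<Rightarrow> real \<Rightarrow> real).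
          (\<forall>i<n. y i \<in> T (x i)) \<and>
          (\<forall>i<n. continuous_on {0..1} (g i) \<and> g i ` {0..1} \<subseteq> {0..1} \<and> g i 0 = 0 \<and> g i 1 = 1) \<and>
          (\<forall>l \<in> standard_simplex (n - 1).
             (\<lambda>i. if i < n then g i (l i) else 0) \<in> standard_simplex (n - 1)) \<and>
          (\<forall>l \<in> standard_simplex (n - 1).
             (\<Sum>i<n. g i (l i) *\<^sub>R y i) \<in> T (\<Sum>i<n. l i *\<^sub>R x i))))"

end

theory Submission
  imports Defs
begin

text \<open>
  The idea is to read weak natural quasi-concavity at the vertices \<open>v\<^sub>i\<close> of the simplex \<open>K\<close>.
  It yields points \<open>y\<^sub>i\<close> and functions \<open>g\<^sub>i\<close> such that \<open>\<Sum>\<^sub>i g\<^sub>i(\<lambda>\<^sub>i) y\<^sub>i\<close> lies in the value of \<open>T\<close>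
  at \<open>\<Sum>\<^sub>i \<lambda>\<^sub>i v\<^sub>i\<close>. Every point \<open>x\<close> of \<open>K\<close> has the form \<open>\<Sum>\<^sub>i \<lambda>\<^sub>i v\<^sub>i\<close> for a unique \<open>\<lambda>\<close>, so
  \<open>x \<mapsto> \<Sum>\<^sub>i g\<^sub>i(\<lambda>\<^sub>i(x)) y\<^sub>i\<close> is a well-defined selection of \<open>T\<close>. It is continuous as soon as the
  barycentric coordinates \<open>\<lambda>\<^sub>i\<close> are.

  Their continuity (lemma \<open>simplex_barycentric_coordinates\<close>) is a compactness argument:
  \<open>\<lambda> \<mapsto> \<Sum>\<^sub>i \<lambda>\<^sub>i v\<^sub>i\<close> is a continuous bijection from the compact standard simplex onto \<open>K\<close>, which is
  a Hausdorff space, so its inverse is continuous.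
\<close>

lemma continuous_on_scaleR_tvs:
  fixes g :: "'a::topological_space \<Rightarrow> 'b::real_topological_vector_space"
  assumes "continuous_on S f" and "continuous_on S g"
  shows "continuous_on S (\<lambda>x. f x *\<^sub>R g x)"
proof -
  have "((\<lambda>x. f x *\<^sub>R g x) \<longlongrightarrow> f a *\<^sub>R g a) (at a within S)" if "a \<in> S" for a
    using filterlim_compose[OF tendsto_scaleR_Pair filterlim_Pair] assms that
    by (fastforce simp: continuous_on_def)
  then show ?thesis
    by (simp add: continuous_on_def)
qed

lemma compact_standard_simplex: "compact (standard_simplex p)"
  using compactin_standard_simplex[of p]
  by (simp add: euclidean_product_topology)

lemma convex_hull_eq_image_standard_simplex:
  fixes v :: "nat \<Rightarrow> 'a::real_vector"
  assumes "inj_on v {..p}"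
  shows "convex hull (v ` {..p}) = (\<lambda>l. \<Sum>i\<le>p. l i *\<^sub>R v i) ` standard_simplex p"
proof (intro equalityI subsetI)
  fix x assume "x \<in> convex hull (v ` {..p})"
  then obtain u where u: "\<forall>z\<in>v ` {..p}. 0 \<le> u z" "sum u (v ` {..p}) = 1"
      "(\<Sum>z\<in>v ` {..p}. u z *\<^sub>R z) = x"
    by (auto simp: convex_hull_finite)
  define l where "l i = (if i \<le> p then u (v i) else 0)" for i
  have sum1: "(\<Sum>i\<le>p. l i) = 1"
    using u(2) assms by (simp add: sum.reindex l_def)
  have nonneg: "0 \<le> l i" for i
    using u(1) by (simp add: l_def)
  have le1: "l i \<le> 1" for i
  proof (cases "i \<le> p")
    case True
    then have "l i \<le> (\<Sum>i\<le>p. l i)"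
      by (intro member_le_sum) (auto simp: nonneg)
    with sum1 show ?thesis by simp
  qed (simp add: l_def)
  have "l \<in> standard_simplex p"
    using sum1 nonneg le1 by (auto simp: standard_simplex_def l_def)
  moreover have "(\<Sum>i\<le>p. l i *\<^sub>R v i) = x"
    using u(3) assms by (simp add: sum.reindex l_def)
  ultimately show "x \<in> (\<lambda>l. \<Sum>i\<le>p. l i *\<^sub>R v i) ` standard_simplex p"
    by blast
next
  fix x assume "x \<in> (\<lambda>l. \<Sum>i\<le>p. l i *\<^sub>R v i) ` standard_simplex p"
  then obtain l where "l \<in> standard_simplex p" "x = (\<Sum>i\<le>p. l i *\<^sub>R v i)"
    by blast
  then show "x \<in> convex hull (v ` {..p})"
    by (auto simp: standard_simplex_def intro!: convex_sum convex_convex_hull intro: hull_inc)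
qed

lemma inj_on_affine_combination:
  fixes v :: "nat \<Rightarrow> 'a::real_vector"
  assumes inj: "inj_on v {..p}" and indep: "\<not> affine_dependent (v ` {..p})"
  shows "inj_on (\<lambda>l. \<Sum>i\<le>p. l i *\<^sub>R v i) (standard_simplex p)"
proof (rule inj_onI)
  fix l m
  assume l: "l \<in> standard_simplex p" and m: "m \<in> standard_simplex p"
    and eq: "(\<Sum>i\<le>p. l i *\<^sub>R v i) = (\<Sum>i\<le>p. m i *\<^sub>R v i)"
  \<comment> \<open>The difference of the two coordinate tuples, transported to the vertices, would be an
    affine dependence.\<close>
  define U where "U z = l (the_inv_into {..p} v z) - m (the_inv_into {..p} v z)" for z
  have U: "U (v i) = l i - m i" if "i \<le> p" for i
    using that inj by (simp add: U_def the_inv_into_f_f)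
  have "sum U (v ` {..p}) = 0"
    using l m inj by (simp add: sum.reindex U sum_subtractf standard_simplex_def)
  moreover have "(\<Sum>z\<in>v ` {..p}. U z *\<^sub>R z) = 0"
    using eq inj by (simp add: sum.reindex U scaleR_left_diff_distrib sum_subtractf)
  ultimately have "\<forall>z\<in>v ` {..p}. U z = 0"
    using indep by (auto simp: affine_dependent_explicit_finite)
  then have "l i = m i" for i
    using U l m by (cases "i \<le> p") (auto simp: standard_simplex_def)
  then show "l = m" ..
qed

text \<open>
  The Hausdorff property is what makes the inverse continuous: a continuous bijection from a
  compact space onto a Hausdorff space is a homeomorphism.
\<close>

lemma simplex_barycentric_coordinates:
  fixes v :: "nat \<Rightarrow> 'a::{real_topological_vector_space, t2_space}"
  assumes "inj_on v {..p}" and "\<not> affine_dependent (v ` {..p})"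
  obtains b where "continuous_on (convex hull (v ` {..p})) b"
    and "b ` (convex hull (v ` {..p})) \<subseteq> standard_simplex p"
    and "\<And>x. x \<in> convex hull (v ` {..p}) \<Longrightarrow> (\<Sum>i\<le>p. b x i *\<^sub>R v i) = x"
proof
  define \<Phi> where "\<Phi> l = (\<Sum>i\<le>p. l i *\<^sub>R v i)" for l :: "nat \<Rightarrow> real"
  define b where "b = the_inv_into (standard_simplex p) \<Phi>"
  have hull: "convex hull (v ` {..p}) = \<Phi> ` standard_simplex p"
    unfolding \<Phi>_def by (rule convex_hull_eq_image_standard_simplex[OF assms(1)])
  have inj: "inj_on \<Phi> (standard_simplex p)"
    unfolding \<Phi>_def by (rule inj_on_affine_combination[OF assms])
  have "continuous_on (standard_simplex p) \<Phi>"
    unfolding \<Phi>_def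
    by (intro continuous_on_sum continuous_on_scaleR_tvs continuous_on_const
        continuous_on_subset[OF continuous_on_product_coordinates subset_UNIV])
  then show "continuous_on (convex hull (v ` {..p})) b"
    unfolding hull
    by (rule continuous_on_inv[OF _ compact_standard_simplex])
      (simp add: b_def the_inv_into_f_f[OF inj])
  show "b ` (convex hull (v ` {..p})) \<subseteq> standard_simplex p"
    using inj by (auto simp: hull b_def the_inv_into_f_f)
  show "(\<Sum>i\<le>p. b x i *\<^sub>R v i) = x" if "x \<in> convex hull (v ` {..p})" for x
    using f_the_inv_into_f[OF inj] that unfolding hull b_def \<Phi>_def by blast
qed

theorem theorem6:
  fixes Y :: "'e::real_topological_vector_space set"
    and K :: "'f::{real_topological_vector_space, t2_space} set"
    and T :: "'f \<Rightarrow> 'e set"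
    and n :: nat
  assumes "Y \<noteq> {}"
    and "n \<ge> 1"
    and "is_simplex (n - 1) K"
    and "\<And>x. x \<in> K \<Longrightarrow> T x \<subseteq> Y"
    and "weakly_naturally_quasi_concave K T"
  shows "\<exists>f. continuous_on K f \<and> f ` K \<subseteq> Y \<and> (\<forall>x\<in>K. f x \<in> T x)"
proof -
  obtain C where C: "finite C" "card C = n" "\<not> affine_dependent C" "K = convex hull C"
    using assms(2,3) by (auto simp: is_simplex_def)
  obtain v where bij: "bij_betw v {..<n} C"
    using ex_bij_betw_nat_finite[OF C(1)] C(2) by (auto simp: atLeast0LessThan)
  have idx: "{..<n} = {..n - 1}"
    using assms(2) by auto
  have inj: "inj_on v {..<n}" and img: "v ` {..<n} = C"
    using bij by (auto simp: bij_betw_def)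
  have "v ` {..<n} \<subseteq> K"
    by (simp add: img C(4) hull_subset)
  with inj assms(2,5) obtain y :: "nat \<Rightarrow> 'e" and g :: "nat \<Rightarrow> real \<Rightarrow> real"
    where g: "\<forall>i<n. continuous_on {0..1} (g i)"
      and sel: "\<forall>l\<in>standard_simplex (n - 1). (\<Sum>i<n. g i (l i) *\<^sub>R y i) \<in> T (\<Sum>i<n. l i *\<^sub>R v i)"
    unfolding weakly_naturally_quasi_concave_def by meson
  obtain b where b: "continuous_on K b" "b ` K \<subseteq> standard_simplex (n - 1)"
      "\<And>x. x \<in> K \<Longrightarrow> (\<Sum>i<n. b x i *\<^sub>R v i) = x"
    using simplex_barycentric_coordinates[of v "n - 1"] inj C(3)
    by (metis C(4) idx img)
  define f where "f x = (\<Sum>i<n. g i (b x i) *\<^sub>R y i)" for x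
  have in_T: "f x \<in> T x" if "x \<in> K" for x
    using sel b(2) b(3)[OF that] that unfolding f_def by (metis image_subset_iff)
  have coord_cont: "continuous_on K (\<lambda>x. b x i)" for i
    by (rule continuous_on_compose2[OF continuous_on_product_coordinates b(1)]) simp
  have coord_range: "(\<lambda>x. b x i) ` K \<subseteq> {0..1}" for i
    using b(2) by (auto simp: standard_simplex_def)
  have "continuous_on K f"
    unfolding f_def
    using g by (intro continuous_on_sum continuous_on_scaleR_tvs continuous_on_const
        continuous_on_compose2[OF _ coord_cont coord_range]) auto
  moreover have "f ` K \<subseteq> Y"
    using in_T assms(4) by blast
  ultimately show ?thesis
    using in_T by blast
qed

end
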